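(* There exists a bounded linear operator $T$ on $L_1(\mathbb R)$ such that $\sup_{n} n\,\|T^{n+1}-T^n\|<\infty$ and $\|T^n\|\approx \log n$.
   Context: $L_1(\mathbb R)$ is the complex Banach space of (classes of) Lebesgue-integrable complex-valued functions on $\mathbb R$. The supremum is over positive integers $n$. The notation $\|T^n\|\approx\log n$ means that there are constants $0<c\le C<\infty$ such that $c\log n\le \|T^n\|\le C\log n$ for all sufficiently large positive integers $n$. *)

theory Defs
  imports "HOL-Analysis.Analysis"
begin

text \<open>The complex Banach space \<open>L\<^sub>1(\<real>)\<close>. It is a partial quotient: the relation is reflexive exactly
  on the Lebesgue-integrable functions \<open>\<real> \<Rightarrow> \<complex>\<close>, so only those have a class.\<close>

definition L1_rel :: "(real \<Rightarrow> complex) \<Rightarrow> (real \<Rightarrow> complex) \<Rightarrow> bool" where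
  "L1_rel f g \<longleftrightarrow> integrable lebesgue f \<and> integrable lebesgue g \<and> (AE x in lebesgue. f x = g x)"

lemma L1_rel_refl_iff: "L1_rel f f \<longleftrightarrow> integrable lebesgue f"
  by (simp add: L1_rel_def)

lemma part_equivp_L1_rel: "part_equivp L1_rel"
proof (rule part_equivpI)
  show "\<exists>f. L1_rel f f"
    by (rule exI[of _ "\<lambda>_. 0"]) (simp add: L1_rel_def)
  show "symp L1_rel"
    by (rule sympI) (auto simp: L1_rel_def elim: eventually_mono)
  show "transp L1_rel"
    by (rule transpI) (auto simp: L1_rel_def elim: eventually_elim2)
qed

quotient_type L1 = "real \<Rightarrow> complex" / partial: L1_rel
  morphisms rep_L1 abs_L1
  by (rule part_equivp_L1_rel)

instantiation L1 :: ab_group_add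
begin

lift_definition zero_L1 :: L1 is "\<lambda>_. 0"
  by (simp add: L1_rel_def)

lift_definition plus_L1 :: "L1 \<Rightarrow> L1 \<Rightarrow> L1" is "\<lambda>f g x. f x + g x"
  by (auto simp: L1_rel_def)

lift_definition uminus_L1 :: "L1 \<Rightarrow> L1" is "\<lambda>f x. - f x"
  by (auto simp: L1_rel_def)

lift_definition minus_L1 :: "L1 \<Rightarrow> L1 \<Rightarrow> L1" is "\<lambda>f g x. f x - g x"
  by (auto simp: L1_rel_def)

instance
  by standard (transfer, simp add: L1_rel_def algebra_simps)+

end

lift_definition scaleC_L1 :: "complex \<Rightarrow> L1 \<Rightarrow> L1"  (infixr "*\<^sub>C" 75) is "\<lambda>c f x. c * f x"
  by (auto simp: L1_rel_def)

lemma scaleC_L1_add_right: "c *\<^sub>C (f + g) = c *\<^sub>C f + c *\<^sub>C g"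
  by transfer (simp add: L1_rel_def algebra_simps)

lemma scaleC_L1_add_left: "(c + d) *\<^sub>C f = c *\<^sub>C f + d *\<^sub>C f"
  by transfer (simp add: L1_rel_def algebra_simps)

lemma scaleC_L1_scaleC: "c *\<^sub>C d *\<^sub>C f = (c * d) *\<^sub>C f"
  by transfer (simp add: L1_rel_def algebra_simps)

lemma scaleC_L1_one: "1 *\<^sub>C f = f"
  by transfer (simp add: L1_rel_def)

instantiation L1 :: real_normed_vector
begin

definition scaleR_L1 :: "real \<Rightarrow> L1 \<Rightarrow> L1" where
  "scaleR_L1 r f = complex_of_real r *\<^sub>C f"

lift_definition norm_L1 :: "L1 \<Rightarrow> real" is "\<lambda>f. \<integral>x. cmod (f x) \<partial>lebesgue"
  unfolding L1_rel_def by (intro integral_cong_AE) auto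

definition dist_L1 :: "L1 \<Rightarrow> L1 \<Rightarrow> real" where
  "dist_L1 f g = norm (f - g)"

definition sgn_L1 :: "L1 \<Rightarrow> L1" where
  "sgn_L1 f = inverse (norm f) *\<^sub>R f"

definition uniformity_L1 :: "(L1 \<times> L1) filter" where
  "uniformity_L1 = (INF e\<in>{0<..}. principal {(f, g). dist f g < e})"

definition open_L1 :: "L1 set \<Rightarrow> bool" where
  "open_L1 U \<longleftrightarrow> (\<forall>f\<in>U. eventually (\<lambda>(f', g). f' = f \<longrightarrow> g \<in> U) uniformity)"

instance
proof
  fix f g :: L1 and a b :: real
  show "dist f g = norm (f - g)" by (rule dist_L1_def)
  show "sgn f = inverse (norm f) *\<^sub>R f" by (rule sgn_L1_def)
  show "uniformity = (INF e\<in>{0<..}. principal {(f::L1, g). dist f g < e})"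
    by (rule uniformity_L1_def)
  show "open U \<longleftrightarrow> (\<forall>f\<in>U. eventually (\<lambda>(f', g). f' = f \<longrightarrow> g \<in> U) uniformity)" for U :: "L1 set"
    by (rule open_L1_def)
  show "a *\<^sub>R (f + g) = a *\<^sub>R f + a *\<^sub>R g"
    by (simp add: scaleR_L1_def scaleC_L1_add_right)
  show "(a + b) *\<^sub>R f = a *\<^sub>R f + b *\<^sub>R f"
    by (simp add: scaleR_L1_def scaleC_L1_add_left)
  show "a *\<^sub>R b *\<^sub>R f = (a * b) *\<^sub>R f"
    by (simp add: scaleR_L1_def scaleC_L1_scaleC)
  show "1 *\<^sub>R f = f"
    by (simp add: scaleR_L1_def scaleC_L1_one)
  show "norm f = 0 \<longleftrightarrow> f = 0"
    by transfer (simp add: L1_rel_def integral_nonneg_eq_0_iff_AE)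
  show "norm (f + g) \<le> norm f + norm g"
  proof transfer
    fix f g assume "L1_rel f f" "L1_rel g g"
    then have "integrable lebesgue f" "integrable lebesgue g"
      by (auto simp: L1_rel_def)
    then have "(\<integral>x. cmod (f x + g x) \<partial>lebesgue) \<le> (\<integral>x. cmod (f x) + cmod (g x) \<partial>lebesgue)"
      by (intro integral_mono) (auto intro: norm_triangle_ineq)
    also have "\<dots> = (\<integral>x. cmod (f x) \<partial>lebesgue) + (\<integral>x. cmod (g x) \<partial>lebesgue)"
      using \<open>integrable lebesgue f\<close> \<open>integrable lebesgue g\<close> by simp
    finally show "(\<integral>x. cmod (f x + g x) \<partial>lebesgue)
      \<le> (\<integral>x. cmod (f x) \<partial>lebesgue) + (\<integral>x. cmod (g x) \<partial>lebesgue)" .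
  qed
  show "norm (a *\<^sub>R f) = \<bar>a\<bar> * norm f"
    unfolding scaleR_L1_def by transfer (simp add: norm_mult)
qed

end

lemma norm_scaleC_L1: "norm (c *\<^sub>C f) = cmod c * norm f"
  by transfer (simp add: norm_mult)

lemma norm_abs_L1: "integrable lebesgue f \<Longrightarrow> norm (abs_L1 f) = (\<integral>x. cmod (f x) \<partial>lebesgue)"
  by (simp add: norm_L1.abs_eq L1_rel_def)

lemma minus_abs_L1:
  "integrable lebesgue f \<Longrightarrow> integrable lebesgue g \<Longrightarrow> abs_L1 f - abs_L1 g = abs_L1 (\<lambda>x. f x - g x)"
  by (simp add: minus_L1.abs_eq L1_rel_def)

lemma abs_L1_cases:
  obtains f where "F = abs_L1 f" "integrable lebesgue f"
proof (rule that)
  show "F = abs_L1 (rep_L1 F)"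
    by (rule Quotient_abs_rep[OF Quotient_L1, symmetric])
  show "integrable lebesgue (rep_L1 F)"
    using Quotient_rep_reflp[OF Quotient_L1, of F] by (simp add: L1_rel_refl_iff)
qed

instance L1 :: banach
proof
  fix X :: "nat \<Rightarrow> L1"
  assume "Cauchy X"
  have "\<exists>f. X n = abs_L1 f \<and> integrable lebesgue f" for n
    by (rule abs_L1_cases[of "X n"]) blast
  then obtain f where X: "X n = abs_L1 (f n)" and int[simp]: "integrable lebesgue (f n)" for n
    by metis
  have "\<exists>r. strict_mono r \<and> (\<forall>n. \<forall>k\<ge>r n. dist (X k) (X (r n)) < (1/2) ^ n)"
  proof -
    have "\<exists>N. \<forall>m\<ge>N. \<forall>k\<ge>N. dist (X m) (X k) < (1/2) ^ n" for n :: nat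
      using \<open>Cauchy X\<close> unfolding Cauchy_def by (meson zero_less_power half_gt_zero zero_less_one)
    then obtain N where N: "\<And>n m k. m \<ge> N n \<Longrightarrow> k \<ge> N n \<Longrightarrow> dist (X m) (X k) < (1/2) ^ n"
      by metis
    define r where "r n = n + (\<Sum>i\<le>n. N i)" for n
    have "strict_mono r"
      by (auto simp: strict_mono_Suc_iff r_def)
    moreover have "N n \<le> r n" for n
      using member_le_sum[of n "{..n}" N] by (simp add: r_def)
    ultimately show ?thesis
      using N by (meson order_trans)
  qed
  then obtain r where r: "strict_mono r" and rd: "\<And>n k. k \<ge> r n \<Longrightarrow> dist (X k) (X (r n)) < (1/2) ^ n"
    by metis
  define d where "d n x = f (r (Suc n)) x - f (r n) x" for n x
  have intd[simp]: "integrable lebesgue (d n)" for n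
    unfolding d_def by simp
  then have [measurable]: "d n \<in> borel_measurable lebesgue" for n
    by (rule borel_measurable_integrable)
  have dn: "(\<integral>x. cmod (d n x) \<partial>lebesgue) \<le> (1/2) ^ n" for n
  proof -
    have "dist (X (r (Suc n))) (X (r n)) < (1/2) ^ n"
      using rd r by (meson lessI less_imp_le strict_mono_less)
    then show ?thesis
      by (simp add: dist_L1_def X minus_abs_L1 norm_abs_L1 d_def)
  qed
  have sum_int: "summable (\<lambda>n. \<integral>x. cmod (d n x) \<partial>lebesgue)"
    by (rule summable_comparison_test'[of "\<lambda>n. (1/2) ^ n"]) (use dn in auto)
  have AE_sum: "AE x in lebesgue. summable (\<lambda>n. cmod (d n x))"
  proof -
    have "(\<integral>\<^sup>+x. (\<Sum>n. ennreal (cmod (d n x))) \<partial>lebesgue) = (\<Sum>n. \<integral>\<^sup>+x. ennreal (cmod (d n x)) \<partial>lebesgue)"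
      by (rule nn_integral_suminf) measurable
    also have "\<dots> = (\<Sum>n. ennreal (\<integral>x. cmod (d n x) \<partial>lebesgue))"
      by (intro arg_cong[where f=suminf] ext nn_integral_eq_integral) auto
    also have "\<dots> \<noteq> \<infinity>"
      by (simp add: ennreal_suminf_neq_top[OF sum_int])
    finally have "AE x in lebesgue. (\<Sum>n. ennreal (cmod (d n x))) \<noteq> \<infinity>"
      by (intro nn_integral_PInf_AE) auto
    then show ?thesis
      by eventually_elim (auto intro!: summable_suminf_not_top)
  qed
  define h where "h x = f (r 0) x + (\<Sum>n. d n x)" for x
  have inth[simp]: "integrable lebesgue h"
    unfolding h_def using integrable_suminf[OF intd AE_sum sum_int] by simp
  have "dist (X (r n)) (abs_L1 h) \<le> (\<Sum>k. \<integral>x. cmod (d (k + n) x) \<partial>lebesgue)" for n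
  proof -
    let ?g = "\<lambda>x. \<Sum>k. cmod (d (k + n) x)"
    have sumn: "summable (\<lambda>k. \<integral>x. cmod (d (k + n) x) \<partial>lebesgue)"
      using sum_int by (simp add: summable_iff_shift[of "\<lambda>k. \<integral>x. cmod (d k x) \<partial>lebesgue"])
    have AEn: "AE x in lebesgue. summable (\<lambda>k. cmod (d (k + n) x))"
      using AE_sum by eventually_elim (simp add: summable_iff_shift[of "\<lambda>k. cmod (d k _)"])
    have intg: "integrable lebesgue ?g"
      by (rule integrable_suminf) (use AEn sumn in auto)
    have "AE x in lebesgue. cmod (f (r n) x - h x) \<le> ?g x"
      using AE_sum
    proof eventually_elim
      fix x assume s: "summable (\<lambda>n. cmod (d n x))"
      have "f (r n) x = f (r 0) x + (\<Sum>k<n. d k x)"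
        using sum_lessThan_telescope[of "\<lambda>k. f (r k) x" n] by (simp add: d_def)
      then have "h x - f (r n) x = (\<Sum>k. d (k + n) x)"
        using suminf_minus_initial_segment[OF summable_norm_cancel[OF s], of n] by (simp add: h_def)
      moreover have "cmod (\<Sum>k. d (k + n) x) \<le> ?g x"
        by (rule summable_norm) (use s in \<open>simp add: summable_iff_shift[of "\<lambda>k. cmod (d k x)"]\<close>)
      ultimately show "cmod (f (r n) x - h x) \<le> ?g x"
        by (simp add: norm_minus_commute)
    qed
    then have "(\<integral>x. cmod (f (r n) x - h x) \<partial>lebesgue) \<le> (\<integral>x. ?g x \<partial>lebesgue)"
      by (intro integral_mono_AE intg) auto
    also have "\<dots> = (\<Sum>k. \<integral>x. cmod (d (k + n) x) \<partial>lebesgue)"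
      by (rule integral_suminf) (use AEn sumn in auto)
    finally show ?thesis
      by (simp add: dist_L1_def X minus_abs_L1 norm_abs_L1)
  qed
  then have "\<forall>n. norm (dist (X (r n)) (abs_L1 h)) \<le> (\<Sum>k. \<integral>x. cmod (d (k + n) x) \<partial>lebesgue)"
    by simp
  moreover have "(\<lambda>n. \<Sum>k. \<integral>x. cmod (d (k + n) x) \<partial>lebesgue) \<longlonglongrightarrow> 0"
    by (rule suminf_exist_split2[OF sum_int])
  ultimately have "(\<lambda>n. dist (X (r n)) (abs_L1 h)) \<longlonglongrightarrow> 0"
    by (rule Lim_null_comparison[OF always_eventually])
  then have "(X \<circ> r) \<longlonglongrightarrow> abs_L1 h"
    by (subst tendsto_dist_iff) (simp only: o_def)
  then show "convergent X"
    using Cauchy_converges_subseq[OF \<open>Cauchy X\<close> r] by (auto simp: convergent_def)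
qed

text \<open>Since the scalar field of \<open>L\<^sub>1(\<real>)\<close> is \<open>\<complex>\<close>, an operator has to be \<open>\<complex>\<close>-linear, whereas
  \<^const>\<open>bounded_linear\<close> only asks for \<open>\<real>\<close>-linearity. The operator norm is \<^const>\<open>onorm\<close>; its
  defining formula does not depend on the scalar field.\<close>

definition bounded_operator_L1 :: "(L1 \<Rightarrow> L1) \<Rightarrow> bool" where
  "bounded_operator_L1 T \<longleftrightarrow> bounded_linear T \<and> (\<forall>c f. T (c *\<^sub>C f) = c *\<^sub>C T f)"

end

theory Submission
  imports Defs
begin

text \<open>
  Let \<open>\<phi>(f) = mass f\<close> be the integral of \<open>f\<close> over \<open>[-1,0)\<close>. For a bounded integrable real function \<open>u\<close>
  vanishing on the negative half-line put \<open>D u f = u \<cdot> (f + \<phi>(f))\<close>, where \<open>\<phi>(f)\<close> is read as a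
  constant function: \<open>D u\<close> is multiplication by \<open>u\<close> perturbed by an operator of rank one. As
  \<open>\<phi>(D v f) = 0\<close>, we have \<open>D u \<circ> D v = D (u \<cdot> v)\<close>, so \<open>u \<mapsto> D u\<close> is a homomorphism of algebras.
  Two facts on its size suffice: if \<open>\<bar>u\<bar> \<le> B\<close>, then \<open>\<parallel>D u\<parallel> \<le> B + \<parallel>u\<parallel>\<^sub>1\<close>; and \<open>D u\<close> sends
  the indicator function of \<open>[-1,0)\<close> to \<open>u\<close>.

  Take \<open>w(x) = exp (-x)\<close> for \<open>x \<ge> 0\<close> and \<open>w(x) = 0\<close> for \<open>x < 0\<close>, and \<open>T = I - D w\<close>. Then
  \<open>T\<^sup>n = I - D (1 - (1 - w)\<^sup>n)\<close> and \<open>T\<^sup>n - T\<^sup>n\<^sup>+\<^sup>1 = D (w (1 - w)\<^sup>n)\<close>. With \<open>t = 1 - exp (-x)\<close> as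
  new variable, \<open>w (1 - w)\<^sup>n\<close> has integral \<open>\<integral>\<^sub>0\<^sup>1 t\<^sup>n dt = 1/(n+1)\<close>, and it is bounded by the
  maximum of \<open>(1 - t) t\<^sup>n\<close> on \<open>[0,1]\<close>, which is at most \<open>1/(n+1)\<close> as well; so the differences
  are of order \<open>1/n\<close>. On the other hand, \<open>1 - (1 - w)\<^sup>n\<close> is the sum of the \<open>w (1 - w)\<^sup>k\<close> with
  \<open>k < n\<close>, so its integral is the harmonic number \<open>1 + 1/2 + \<dots> + 1/n\<close>, which is what \<open>\<parallel>T\<^sup>n\<parallel>\<close>
  amounts to up to a bounded error.
\<close>

section \<open>Multiplication operators with a perturbation of rank one\<close>

definition admissible :: "(real \<Rightarrow> real) \<Rightarrow> bool" where
  "admissible u \<longleftrightarrow> integrable lebesgue u \<and> (\<exists>B. \<forall>x. \<bar>u x\<bar> \<le> B) \<and> (\<forall>x<0. u x = 0)"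

lift_definition mass :: "L1 \<Rightarrow> complex" is
  "\<lambda>f. \<integral>x. indicator {-1..<0} x *\<^sub>R f x \<partial>lebesgue"
  unfolding L1_rel_def
  by (intro integral_cong_AE)
    (auto intro!: borel_measurable_scaleR borel_measurable_indicator dest: borel_measurable_integrable)

lemma integrable_bounded_mult:
  fixes u :: "real \<Rightarrow> real" and f :: "real \<Rightarrow> complex"
  assumes "integrable lebesgue f" "u \<in> borel_measurable lebesgue" "\<And>x. \<bar>u x\<bar> \<le> B"
  shows "integrable lebesgue (\<lambda>x. of_real (u x) * f x)"
proof (rule Bochner_Integration.integrable_bound)
  show "integrable lebesgue (\<lambda>x. B *\<^sub>R f x)"
    using assms(1) by simp
  show "AE x in lebesgue. norm (of_real (u x) * f x) \<le> norm (B *\<^sub>R f x)"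
    using assms(3) by (intro AE_I2) (auto simp: norm_mult intro!: mult_right_mono order_trans[OF _ abs_ge_self])
qed (use assms(1,2) in measurable)

lemma integrable_admissible_mult:
  fixes f :: "real \<Rightarrow> complex"
  assumes "admissible u" "integrable lebesgue f"
  shows "integrable lebesgue (\<lambda>x. of_real (u x) * (f x + c))"
proof -
  obtain B where "\<And>x. \<bar>u x\<bar> \<le> B" and u: "integrable lebesgue u"
    using assms(1) by (auto simp: admissible_def)
  then have "integrable lebesgue (\<lambda>x. of_real (u x) * f x)"
    using assms(2) by (intro integrable_bounded_mult) auto
  moreover have "integrable lebesgue (\<lambda>x. complex_of_real (u x) * c)"
    using u by simp
  ultimately show ?thesis
    by (simp add: distrib_left)
qed

text \<open>For \<open>u\<close> that is not admissible the product need not be integrable; the value \<open>0\<close> keeps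
  \<open>D u\<close> a map between classes of integrable functions.\<close>

lift_definition D :: "(real \<Rightarrow> real) \<Rightarrow> L1 \<Rightarrow> L1" is
  "\<lambda>u f x. if admissible u
     then of_real (u x) * (f x + (\<integral>y. indicator {-1..<0} y *\<^sub>R f y \<partial>lebesgue)) else 0"
proof -
  fix u and f g :: "real \<Rightarrow> complex"
  assume fg: "L1_rel f g"
  then have "mass (abs_L1 f) = mass (abs_L1 g)"
    by (intro arg_cong[where f = mass] Quotient_rel_abs[OF Quotient_L1])
  then have "(\<integral>y. indicator {-1..<0} y *\<^sub>R f y \<partial>lebesgue) = (\<integral>y. indicator {-1..<0} y *\<^sub>R g y \<partial>lebesgue)"
    using fg by (simp add: mass.abs_eq L1_rel_def)
  then show "?thesis u f g"
    using fg by (cases "admissible u") (auto simp: L1_rel_def integrable_admissible_mult)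
qed

lemma mass_abs_L1:
  "integrable lebesgue f \<Longrightarrow> mass (abs_L1 f) = (\<integral>x. indicator {-1..<0} x *\<^sub>R f x \<partial>lebesgue)"
  by (simp add: mass.abs_eq L1_rel_def)

lemma D_abs_L1:
  assumes "admissible u" "integrable lebesgue f"
  shows "D u (abs_L1 f) = abs_L1 (\<lambda>x. of_real (u x) * (f x + mass (abs_L1 f)))"
  using assms by (simp add: D.abs_eq L1_rel_def mass_abs_L1)

lemma mass_add: "mass (f + g) = mass f + mass g"
  by transfer (simp add: L1_rel_def algebra_simps integrable_mult_indicator)

lemma mass_scaleC: "mass (c *\<^sub>C f) = c * mass f"
  by transfer (simp add: mult_scaleR_right[symmetric] del: mult_scaleR_right)

lemma norm_mass_le: "norm (mass f) \<le> norm f"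
proof transfer
  fix f assume "L1_rel f f"
  then have f: "integrable lebesgue f"
    by (simp add: L1_rel_def)
  have "norm (\<integral>x. indicator {-1..<0} x *\<^sub>R f x \<partial>lebesgue)
      \<le> (\<integral>x. norm (indicator {-1..<0} x *\<^sub>R f x) \<partial>lebesgue)"
    by (rule integral_norm_bound)
  also have "\<dots> \<le> (\<integral>x. norm (f x) \<partial>lebesgue)"
    using f by (intro integral_mono integrable_norm integrable_mult_indicator) (auto simp: indicator_def)
  finally show "norm (\<integral>x. indicator {-1..<0} x *\<^sub>R f x \<partial>lebesgue) \<le> (\<integral>x. norm (f x) \<partial>lebesgue)" .
qed

lemma plus_abs_L1:
  "integrable lebesgue f \<Longrightarrow> integrable lebesgue g \<Longrightarrow> abs_L1 f + abs_L1 g = abs_L1 (\<lambda>x. f x + g x)"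
  by (simp add: plus_L1.abs_eq L1_rel_def)

lemma scaleC_abs_L1:
  "integrable lebesgue f \<Longrightarrow> c *\<^sub>C abs_L1 f = abs_L1 (\<lambda>x. c * f x)"
  by (simp add: scaleC_L1.abs_eq L1_rel_def)

lemma D_add:
  assumes "admissible u"
  shows "D u (F + G) = D u F + D u G"
proof -
  obtain f g where [simp]: "F = abs_L1 f" "G = abs_L1 g" "integrable lebesgue f" "integrable lebesgue g"
    by (metis abs_L1_cases)
  have "D u (F + G) = abs_L1 (\<lambda>x. of_real (u x) * (f x + g x + mass (F + G)))"
    using assms by (simp add: plus_abs_L1 D_abs_L1)
  also have "\<dots> = D u F + D u G"
    unfolding mass_add using assms
    by (simp add: D_abs_L1 plus_abs_L1 integrable_admissible_mult)
      (simp add: algebra_simps)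
  finally show ?thesis .
qed

lemma D_scaleC:
  assumes "admissible u"
  shows "D u (c *\<^sub>C F) = c *\<^sub>C D u F"
proof -
  obtain f where [simp]: "F = abs_L1 f" "integrable lebesgue f"
    by (metis abs_L1_cases)
  have "D u (c *\<^sub>C F) = abs_L1 (\<lambda>x. of_real (u x) * (c * f x + mass (c *\<^sub>C F)))"
    using assms by (simp add: scaleC_abs_L1 D_abs_L1)
  also have "\<dots> = c *\<^sub>C D u F"
    unfolding mass_scaleC using assms
    by (simp add: D_abs_L1 scaleC_abs_L1 integrable_admissible_mult)
      (simp add: algebra_simps)
  finally show ?thesis .
qed

lemma norm_D_le:
  assumes u: "admissible u" and B: "\<And>x. \<bar>u x\<bar> \<le> B"
  shows "norm (D u F) \<le> (B + (\<integral>x. \<bar>u x\<bar> \<partial>lebesgue)) * norm F"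
proof -
  obtain f where F: "F = abs_L1 f" and f: "integrable lebesgue f"
    by (metis abs_L1_cases)
  have int_u: "integrable lebesgue u"
    using u by (simp add: admissible_def)
  let ?c = "mass F"
  have "norm (D u F) = (\<integral>x. norm (of_real (u x) * (f x + ?c)) \<partial>lebesgue)"
    using u f by (simp add: F D_abs_L1 norm_abs_L1 integrable_admissible_mult)
  also have "\<dots> \<le> (\<integral>x. B * norm (f x) + \<bar>u x\<bar> * norm ?c \<partial>lebesgue)"
  proof (rule integral_mono)
    show "integrable lebesgue (\<lambda>x. norm (of_real (u x) * (f x + ?c)))"
      using u f by (intro integrable_norm integrable_admissible_mult)
    show "integrable lebesgue (\<lambda>x. B * norm (f x) + \<bar>u x\<bar> * norm ?c)"
      using f int_u by auto
    fix x
    have "norm (of_real (u x) * (f x + ?c)) \<le> \<bar>u x\<bar> * (norm (f x) + norm ?c)"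
      by (simp add: norm_mult mult_left_mono norm_triangle_ineq)
    also have "\<dots> \<le> B * norm (f x) + \<bar>u x\<bar> * norm ?c"
      using B[of x] by (simp add: distrib_left mult_right_mono)
    finally show "norm (of_real (u x) * (f x + ?c)) \<le> B * norm (f x) + \<bar>u x\<bar> * norm ?c" .
  qed
  also have "\<dots> = B * norm F + (\<integral>x. \<bar>u x\<bar> \<partial>lebesgue) * norm ?c"
    using f int_u by (simp add: F norm_abs_L1)
  also have "\<dots> \<le> B * norm F + (\<integral>x. \<bar>u x\<bar> \<partial>lebesgue) * norm F"
    by (intro add_left_mono mult_left_mono norm_mass_le) simp
  finally show ?thesis
    by (simp add: distrib_right)
qed

lemma bounded_linear_D:
  assumes "admissible u"
  shows "bounded_linear (D u)"
proof -
  obtain B where "\<And>x. \<bar>u x\<bar> \<le> B"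
    using assms by (auto simp: admissible_def)
  then have "norm (D u F) \<le> norm F * (B + (\<integral>x. \<bar>u x\<bar> \<partial>lebesgue))" for F
    using norm_D_le[OF assms] by (simp add: mult.commute)
  then show ?thesis
    using assms by (intro bounded_linear_intro) (auto simp: D_add D_scaleC scaleR_L1_def)
qed

lemma onorm_D_le:
  assumes "admissible u" "\<And>x. \<bar>u x\<bar> \<le> B"
  shows "onorm (D u) \<le> B + (\<integral>x. \<bar>u x\<bar> \<partial>lebesgue)"
proof (rule onorm_bound[OF _ norm_D_le[OF assms]])
  have "0 \<le> B" using assms(2)[of 0] by linarith
  then show "0 \<le> B + (\<integral>x. \<bar>u x\<bar> \<partial>lebesgue)" by simp
qed

lemma admissible_add: "admissible u \<Longrightarrow> admissible v \<Longrightarrow> admissible (\<lambda>x. u x + v x)"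
  unfolding admissible_def
  by (auto, meson abs_triangle_ineq add_mono order_trans)

lemma admissible_mult:
  assumes "admissible u" "v \<in> borel_measurable lebesgue" "\<And>x. \<bar>v x\<bar> \<le> B"
  shows "admissible (\<lambda>x. u x * v x)"
proof -
  obtain A where u: "integrable lebesgue u" and A: "\<And>x. \<bar>u x\<bar> \<le> A" and 0: "\<And>x. x < 0 \<Longrightarrow> u x = 0"
    using assms(1) by (auto simp: admissible_def)
  have "integrable lebesgue (\<lambda>x. u x * v x)"
  proof (rule Bochner_Integration.integrable_bound)
    show "integrable lebesgue (\<lambda>x. B * u x)"
      using u by simp
    have "norm (u x * v x) \<le> norm (B * u x)" for x
      using mult_right_mono[of "\<bar>v x\<bar>" "\<bar>B\<bar>" "\<bar>u x\<bar>"] assms(3)[of x]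
      by (simp add: abs_mult mult.commute)
    then show "AE x in lebesgue. norm (u x * v x) \<le> norm (B * u x)"
      by simp
  qed (use u assms(2) in measurable)
  moreover have "\<bar>u x * v x\<bar> \<le> A * B" for x
    using A[of x] assms(3)[of x] by (simp add: abs_mult mult_mono)
  ultimately show ?thesis
    using 0 by (auto simp: admissible_def)
qed

lemma D_add_left:
  assumes "admissible u" "admissible v"
  shows "D (\<lambda>x. u x + v x) F = D u F + D v F"
proof -
  obtain f where "F = abs_L1 f" "integrable lebesgue f"
    by (metis abs_L1_cases)
  then show ?thesis
    using assms
    by (simp add: D_abs_L1 admissible_add plus_abs_L1 integrable_admissible_mult distrib_right)
qed

lemma mass_D:
  assumes "admissible u"
  shows "mass (D u F) = 0"
proof -
  obtain f where F: "F = abs_L1 f" and f: "integrable lebesgue f"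
    by (metis abs_L1_cases)
  have "(\<lambda>x. indicator {-1..<0} x *\<^sub>R (complex_of_real (u x) * (f x + mass (abs_L1 f)))) = (\<lambda>x. 0)"
    using assms by (auto simp: admissible_def indicator_def)
  then show ?thesis
    using assms f by (simp add: F D_abs_L1 mass_abs_L1[OF integrable_admissible_mult])
qed

text \<open>The term of rank one is lost in the composition because \<open>\<phi>\<close> vanishes on the range of
  \<open>D v\<close>.\<close>

lemma D_D:
  assumes u: "admissible u" and v: "admissible v"
  shows "D u (D v F) = D (\<lambda>x. u x * v x) F"
proof -
  obtain f where F: "F = abs_L1 f" and f: "integrable lebesgue f"
    by (metis abs_L1_cases)
  obtain B where "\<And>x. \<bar>v x\<bar> \<le> B"
    using v by (auto simp: admissible_def)
  with u v have uv: "admissible (\<lambda>x. u x * v x)"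
    by (intro admissible_mult) (auto simp: admissible_def)
  define g where "g x = of_real (v x) * (f x + mass F)" for x
  have g: "integrable lebesgue g"
    unfolding g_def using v f by (rule integrable_admissible_mult)
  have Dv: "D v F = abs_L1 g"
    using v f by (simp add: F D_abs_L1 g_def[abs_def])
  have "D u (D v F) = abs_L1 (\<lambda>x. of_real (u x) * g x)"
    using D_abs_L1[OF u g] mass_D[OF v, of F] by (simp add: Dv)
  also have "\<dots> = D (\<lambda>x. u x * v x) F"
    using uv f by (simp add: F D_abs_L1 g_def mult.assoc)
  finally show ?thesis .
qed

section \<open>A lower bound for the norm\<close>

text \<open>The class \<open>e\<close> of the indicator function of \<open>[-1,0)\<close> has norm \<open>1\<close> and is mapped by \<open>D u\<close>
  to the class of \<open>u\<close>.\<close>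

lemma onorm_id_minus_D_ge:
  assumes u: "admissible u"
  shows "(\<integral>x. \<bar>u x\<bar> \<partial>lebesgue) - 1 \<le> onorm (\<lambda>F. F - D u F)"
proof -
  define f :: "real \<Rightarrow> complex" where "f = indicator {-1..<0}"
  define e where "e = abs_L1 f"
  have "integrable lebesgue (\<lambda>x::real. complex_of_real (indicator {-1..<0} x))"
    by (intro integrable_of_real integrable_real_indicator) auto
  then have f: "integrable lebesgue f"
    by (simp only: f_def of_real_indicator)
  have int1: "(\<integral>x. indicator {-1..<0::real} x \<partial>lebesgue) = (1::real)"
    by simp
  have "cmod (f x) = indicator {-1..<0} x" for x
    by (simp add: f_def indicator_def)
  then have norm_e: "norm e = 1"
    by (simp add: e_def norm_abs_L1[OF f])
  have "mass e = (\<integral>x. complex_of_real (indicator {-1..<0::real} x) \<partial>lebesgue)"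
    unfolding e_def mass_abs_L1[OF f]
    by (rule Bochner_Integration.integral_cong) (auto simp: f_def indicator_def)
  then have mass_e: "mass e = 1"
    using int1 by (simp del: of_real_indicator)
  have "D u e = abs_L1 (\<lambda>x. of_real (u x))"
  proof -
    have "(\<lambda>x. complex_of_real (u x) * (f x + 1)) = (\<lambda>x. of_real (u x))"
      using u by (auto simp: fun_eq_iff admissible_def f_def indicator_def)
    then show ?thesis
      using D_abs_L1[OF u f] mass_e by (simp add: e_def)
  qed
  moreover have "integrable lebesgue (\<lambda>x. complex_of_real (u x))"
    using u by (simp add: admissible_def)
  ultimately have "norm (D u e) = (\<integral>x. \<bar>u x\<bar> \<partial>lebesgue)"
    by (simp add: norm_abs_L1)
  then have "(\<integral>x. \<bar>u x\<bar> \<partial>lebesgue) - 1 \<le> norm (e - D u e)"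
    using norm_triangle_ineq2[of "D u e" e] by (simp add: norm_e norm_minus_commute)
  also have "\<dots> \<le> onorm (\<lambda>F. F - D u F)"
    using le_onorm[of "\<lambda>F. F - D u F" e] bounded_linear_D[OF u]
    by (simp add: norm_e bounded_linear_sub bounded_linear_ident)
  finally show ?thesis .
qed

section \<open>The exponential weight\<close>

definition w :: "real \<Rightarrow> real" where
  "w x = (if 0 \<le> x then exp (-x) else 0)"

definition w_diff :: "nat \<Rightarrow> real \<Rightarrow> real" where
  "w_diff n x = w x * (1 - w x) ^ n"

lemma w_bounds: "0 \<le> w x" "w x \<le> 1"
  by (auto simp: w_def)

lemma w_measurable [measurable]: "w \<in> borel_measurable borel"
  unfolding w_def by measurable

lemma w_diff_measurable [measurable]: "w_diff n \<in> borel_measurable borel"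
  unfolding w_diff_def by measurable

lemma w_diff_nonneg: "0 \<le> w_diff n x"
  using w_bounds[of x] by (simp add: w_diff_def)

text \<open>On \<open>[0,\<infinity>)\<close> the function \<open>(1 - exp (-x))\<^sup>n\<^sup>+\<^sup>1 / (n+1)\<close> is a primitive.\<close>

lemma has_integral_w_diff: "has_bochner_integral lebesgue (w_diff n) (1 / real (Suc n))"
proof -
  let ?P = "\<lambda>x::real. (1 - exp (-x)) ^ Suc n / real (Suc n)"
  let ?p = "\<lambda>x::real. exp (-x) * (1 - exp (-x)) ^ n"
  have "(\<integral>\<^sup>+x. ennreal (?p x) * indicator {0..} x \<partial>lborel) = ennreal (1 / real (Suc n) - ?P 0)"
  proof (rule nn_integral_FTC_atLeast)
    show "(?P has_real_derivative ?p x) (at x)" for x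
      by (rule derivative_eq_intros refl | simp add: field_simps del: of_nat_Suc)+
    show "(?P \<longlongrightarrow> 1 / real (Suc n)) at_top"
    proof -
      have "((\<lambda>x::real. exp (-x)) \<longlongrightarrow> 0) at_top"
        by (rule filterlim_compose[OF exp_at_bot filterlim_uminus_at_bot_at_top])
      then have "(?P \<longlongrightarrow> (1 - 0) ^ Suc n / real (Suc n)) at_top"
        by (intro tendsto_intros) auto
      then show ?thesis
        by (simp add: add.commute)
    qed
  qed auto
  moreover have "ennreal (?p x) * indicator {0..} x = ennreal (w_diff n x)" for x
    by (simp add: w_diff_def w_def indicator_def)
  ultimately have "(\<integral>\<^sup>+x. ennreal (w_diff n x) \<partial>lebesgue) = ennreal (1 / real (Suc n))"
    by (simp add: nn_integral_completion)
  then show ?thesis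
    by (intro has_bochner_integral_nn_integral measurable_completion) (auto simp: w_diff_nonneg)
qed

text \<open>With \<open>t = 1 - w x\<close>, the number \<open>(1 - t) (1 + t + \<dots> + t\<^sup>n)\<close> is at most \<open>1\<close>, and each of the
  \<open>n + 1\<close> powers of \<open>t\<close> is at least \<open>t\<^sup>n\<close>.\<close>

lemma w_diff_le: "w_diff n x \<le> 1 / real (Suc n)"
proof -
  let ?t = "1 - w x"
  have t: "0 \<le> ?t" "?t \<le> 1"
    using w_bounds[of x] by auto
  have "real (Suc n) * ?t ^ n \<le> (\<Sum>i<Suc n. ?t ^ i)"
    using sum_mono[of "{..<Suc n}" "\<lambda>_. ?t ^ n" "\<lambda>i. ?t ^ i"] t
    by (simp add: power_decreasing)
  then have "w x * (real (Suc n) * ?t ^ n) \<le> w x * (\<Sum>i<Suc n. ?t ^ i)"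
    using w_bounds by (intro mult_left_mono)
  also have "\<dots> = 1 - ?t ^ Suc n"
    using one_diff_power_eq[of ?t "Suc n"] by simp
  also have "\<dots> \<le> 1"
    using t(1) by (simp del: power_Suc)
  finally show ?thesis
    by (simp add: w_diff_def field_simps)
qed

lemma admissible_w_diff: "admissible (w_diff n)"
proof -
  have "\<bar>w_diff n x\<bar> \<le> 1 / real (Suc n)" for x
    using w_diff_le w_diff_nonneg by simp
  moreover have "w_diff n x = 0" if "x < 0" for x
    using that by (simp add: w_diff_def w_def)
  ultimately show ?thesis
    using has_integral_w_diff[of n] unfolding admissible_def has_bochner_integral_iff by blast
qed

definition w_sum :: "nat \<Rightarrow> real \<Rightarrow> real" where
  "w_sum n x = 1 - (1 - w x) ^ n"

lemma w_sum_eq_sum: "w_sum n x = (\<Sum>k<n. w_diff k x)"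
  by (simp add: w_sum_def w_diff_def one_diff_power_eq sum_distrib_left)

lemma w_sum_Suc: "w_sum (Suc n) x = w_sum n x + w_diff n x"
  by (simp add: w_sum_eq_sum)

lemma w_sum_bounds: "0 \<le> w_sum n x" "w_sum n x \<le> 1"
  using w_bounds[of x] by (auto simp: w_sum_def power_le_one)

lemma has_integral_w_sum: "has_bochner_integral lebesgue (w_sum n) (harm n)"
proof -
  have "has_bochner_integral lebesgue (\<lambda>x. \<Sum>k<n. w_diff k x) (\<Sum>k<n. 1 / real (Suc k))"
    by (intro has_bochner_integral_sum has_integral_w_diff)
  moreover have "(\<Sum>k<n. 1 / real (Suc k)) = (harm n :: real)"
    by (simp add: harm_altdef inverse_eq_divide)
  moreover have "w_sum n = (\<lambda>x. \<Sum>k<n. w_diff k x)"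
    by (simp add: fun_eq_iff w_sum_eq_sum)
  ultimately show ?thesis
    by simp
qed

lemma integral_w_sum: "(\<integral>x. \<bar>w_sum n x\<bar> \<partial>lebesgue) = harm n"
  using has_integral_w_sum[of n] w_sum_bounds(1)[of n]
  by (simp add: has_bochner_integral_iff)

lemma admissible_w_sum: "admissible (w_sum n)"
proof -
  have "\<bar>w_sum n x\<bar> \<le> 1" for x
    using w_sum_bounds[of n x] by simp
  moreover have "w_sum n x = 0" if "x < 0" for x
    using that by (simp add: w_sum_def w_def)
  ultimately show ?thesis
    using has_integral_w_sum[of n] unfolding admissible_def has_bochner_integral_iff by blast
qed

section \<open>The operator and its powers\<close>

definition T :: "L1 \<Rightarrow> L1" where
  "T F = F - D w F"

lemma w_eq_w_diff_0: "w = w_diff 0"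
  by (simp add: fun_eq_iff w_diff_def)

lemma bounded_operator_T: "bounded_operator_L1 T"
proof -
  have "bounded_linear T"
    unfolding T_def[abs_def] w_eq_w_diff_0
    by (intro bounded_linear_sub bounded_linear_ident bounded_linear_D admissible_w_diff)
  moreover have "c *\<^sub>C (F - G) = c *\<^sub>C F - c *\<^sub>C G" for c and F G :: L1
    using scaleC_L1_add_right[of c "F - G" G] by (simp add: algebra_simps)
  ultimately show ?thesis
    by (simp add: bounded_operator_L1_def T_def w_eq_w_diff_0 D_scaleC admissible_w_diff)
qed

lemma T_power: "(T ^^ n) F = F - D (w_sum n) F"
proof (induction n)
  case 0
  have [simp]: "D (w_sum 0) F = 0"
  proof -
    have "D (w_sum 0) F + D (w_sum 0) F = D (w_sum 0) F"
      using D_add_left[OF admissible_w_sum[of 0] admissible_w_sum[of 0], of F]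
      by (simp add: w_sum_def[abs_def])
    then show ?thesis
      by simp
  qed
  show ?case
    by simp
next
  case (Suc n)
  have w: "admissible w"
    by (simp add: w_eq_w_diff_0 admissible_w_diff)
  \<comment> \<open>By \<open>w = w (1 - (1 - w)\<^sup>n) + w (1 - w)\<^sup>n\<close>, applying \<open>D w\<close> to \<open>F - D (w_sum n) F\<close>
    leaves only the term of \<open>w (1 - w)\<^sup>n\<close>.\<close>
  have "D w F = D (\<lambda>x. w x * w_sum n x + w_diff n x) F"
    by (rule arg_cong[where f = "\<lambda>u. D u F"]) (simp add: fun_eq_iff w_sum_def w_diff_def algebra_simps)
  also have "\<dots> = D w (D (w_sum n) F) + D (w_diff n) F"
  proof -
    have "admissible (\<lambda>x. w x * w_sum n x)"
      using w admissible_w_sum w_sum_bounds[of n]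
      by (intro admissible_mult[where B = 1]) (auto simp: admissible_def)
    then show ?thesis
      by (simp add: D_D[OF w admissible_w_sum] D_add_left admissible_w_diff)
  qed
  finally have "D w (F - D (w_sum n) F) = D (w_diff n) F"
    using bounded_linear.linear[OF bounded_linear_D[OF w]] by (simp add: linear_diff)
  moreover have "D (w_sum (Suc n)) F = D (w_sum n) F + D (w_diff n) F"
    using D_add_left[OF admissible_w_sum admissible_w_diff] by (simp add: w_sum_Suc[abs_def])
  ultimately show ?case
    using Suc by (simp add: T_def)
qed

lemma onorm_T_power_diff_le: "onorm (\<lambda>F. (T ^^ (n + 1)) F - (T ^^ n) F) \<le> 2 / real (Suc n)"
proof -
  have "(T ^^ (n + 1)) F - (T ^^ n) F = - D (w_diff n) F" for F
    using D_add_left[OF admissible_w_sum admissible_w_diff, of n n F]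
    by (simp add: T_power w_sum_Suc[abs_def] del: funpow.simps)
  then have "onorm (\<lambda>F. (T ^^ (n + 1)) F - (T ^^ n) F) = onorm (D (w_diff n))"
    by (simp add: onorm_neg del: funpow.simps)
  also have "\<dots> \<le> 1 / real (Suc n) + (\<integral>x. \<bar>w_diff n x\<bar> \<partial>lebesgue)"
    by (rule onorm_D_le[OF admissible_w_diff]) (use w_diff_le w_diff_nonneg in simp)
  also have "\<dots> = 2 / real (Suc n)"
    using has_integral_w_diff[of n] w_diff_nonneg by (simp add: has_bochner_integral_iff)
  finally show ?thesis .
qed

lemma onorm_T_power_ge: "harm n - 1 \<le> onorm (T ^^ n)"
  using onorm_id_minus_D_ge[OF admissible_w_sum[of n]]
  by (simp add: integral_w_sum T_power[abs_def] fun_eq_iff)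

lemma onorm_T_power_le: "onorm (T ^^ n) \<le> 2 + harm n"
proof -
  have D: "onorm (D (w_sum n)) \<le> 1 + harm n"
    using onorm_D_le[OF admissible_w_sum, of n 1] w_sum_bounds[of n]
    unfolding integral_w_sum by simp
  have "onorm (T ^^ n) = onorm (\<lambda>F. F + - D (w_sum n) F)"
    by (rule arg_cong[where f = onorm]) (simp add: fun_eq_iff T_power)
  also have "\<dots> \<le> 2 + harm n"
    using onorm_id_le[where 'a = L1] D
    by (intro onorm_triangle_le bounded_linear_ident bounded_linear_minus bounded_linear_D
        admissible_w_sum) (simp add: onorm_neg)
  finally show ?thesis .
qed

theorem theorem3p3:
  shows "\<exists>T :: L1 \<Rightarrow> L1.
    bounded_operator_L1 T \<and>
    bdd_above ((\<lambda>n::nat. real n * onorm (\<lambda>f. (T ^^ (n + 1)) f - (T ^^ n) f)) ` {1..}) \<and>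
    (\<exists>c C :: real. 0 < c \<and> c \<le> C \<and>
      (\<forall>\<^sub>F n :: nat in sequentially.
        c * ln (real n) \<le> onorm (T ^^ n) \<and> onorm (T ^^ n) \<le> C * ln (real n)))"
proof (intro exI[of _ T] conjI)
  show "bounded_operator_L1 T"
    by (rule bounded_operator_T)
  show "bdd_above ((\<lambda>n::nat. real n * onorm (\<lambda>f. (T ^^ (n + 1)) f - (T ^^ n) f)) ` {1..})"
  proof (intro bdd_aboveI2)
    fix n :: nat
    have "real n * onorm (\<lambda>f. (T ^^ (n + 1)) f - (T ^^ n) f) \<le> real n * (2 / real (Suc n))"
      by (intro mult_left_mono onorm_T_power_diff_le of_nat_0_le_iff)
    also have "\<dots> \<le> 2"
      by (simp add: field_simps)
    finally show "real n * onorm (\<lambda>f. (T ^^ (n + 1)) f - (T ^^ n) f) \<le> 2" .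
  qed
  \<comment> \<open>From \<open>ln n \<ge> 2\<close> on, the additive errors in \<open>ln n - 1 \<le> \<parallel>T\<^sup>n\<parallel> \<le> ln n + 3\<close> are absorbed
    by the factors \<open>1/2\<close> and \<open>3\<close>.\<close>
  have "\<forall>\<^sub>F n :: nat in sequentially. 2 \<le> ln (real n)"
    by (rule filterlim_at_top[THEN iffD1, rule_format,
          OF filterlim_compose[OF ln_at_top filterlim_real_sequentially]])
  then have "\<forall>\<^sub>F n :: nat in sequentially.
      1/2 * ln (real n) \<le> onorm (T ^^ n) \<and> onorm (T ^^ n) \<le> 3 * ln (real n)"
    using eventually_gt_at_top[of 0]
  proof eventually_elim
    case (elim n)
    have "ln (real n) \<le> ln (real n + 1)"
      using elim by simp
    also have "\<dots> \<le> harm n"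
      by (rule ln_le_harm)
    finally have "ln (real n) \<le> harm n" .
    moreover have "harm n \<le> 1 + ln (real n)"
      using euler_mascheroni_sequence_decreasing[of 1 n] elim by (simp add: harm_expand)
    ultimately show ?case
      using onorm_T_power_ge[of n] onorm_T_power_le[of n] elim by linarith
  qed
  then show "\<exists>c C :: real. 0 < c \<and> c \<le> C \<and>
      (\<forall>\<^sub>F n :: nat in sequentially.
        c * ln (real n) \<le> onorm (T ^^ n) \<and> onorm (T ^^ n) \<le> C * ln (real n))"
    by (intro exI[of _ "1/2"] exI[of _ 3]) simp
qed

end
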